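(* Let $R$ be a Noetherian local domain of positive characteristic $p$, $d=\dim R$, and let $x_1,\ldots,x_d$ be a system of parameters of $R$. Let $y_1,\ldots,y_d$ be a sequence of elements of $R$ such that $(y_1,\ldots,y_d)\subset (x_1,\ldots,x_d)$. If $y_1,\ldots,y_d$ is a system of parameters of $R$, then the natural map $\Phi: H^d_{(x_1,\ldots,x_d)}(R^+)\to H^d_{(y_1,\ldots,y_d)}(R^+)$ is injective.
   Context: $R^+$ denotes the absolute integral closure of the domain $R$, i.e. the integral closure of $R$ in a fixed algebraic closure of its fraction field. For a sequence $\underline{x}=x_1,\ldots,x_d$ in $R$, $H^d_{(\underline{x})}(R^+)$ is identified with $\varinjlim_n R^+/(x_1^n,\ldots,x_d^n)R^+$ (transition maps are multiplication by $x_1\cdots x_d$), and the class of $r\in R^+/(x_1^n,\ldots,x_d^n)R^+$ is denoted $\left[\frac{r}{x_1^n\cdots x_d^n}\right]$. The map $\Phi$: given $u=\left[\frac{r}{x_1^n\cdots x_d^n}\right]\in H^d_{(\underline{x})}(R^+)$, since $(\underline{y})\subset(\underline{x})$ there exist a positive integer $s$ and a $d\times d$ matrix $B=(b_{ij})$ over $R$ with $y_i^s=\sum_j b_{ij}x_j^n$ for all $i$. Then $\Phi(u)=\left[\frac{r\det B}{y_1^s\cdots y_d^s}\right]\in H^d_{(\underline{y})}(R^+)$. This is a well-defined homomorphism, independent of the choices. *)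

theory Defs
  imports
    "HOL-Algebra.Algebraic_Closure_Type"
    "HOL-Algebra.Ring_Divisibility"
    "HOL-Computational_Algebra.Normalized_Fraction"
    "HOL-Library.Extended_Nat"
    "Jordan_Normal_Form.Determinant"
begin

text \<open>
  A domain is a type of class \<open>idom\<close>; the ideal theory of \<open>HOL-Algebra\<close> is applied to it through
  \<^const>\<open>ring_of_type_algebra\<close>.  A sequence \<open>x\<^sub>1, \<dots>, x\<^sub>d\<close> is a function on \<open>nat\<close>, of which only the
  values at \<open>0, \<dots>, d - 1\<close> are used.
\<close>

section \<open>Local rings, dimension, systems of parameters\<close>

definition local_ring :: "('a, 'b) ring_scheme \<Rightarrow> bool" where
  "local_ring R \<longleftrightarrow> cring R \<and> (\<exists>!m. maximalideal m R)"

definition krull_dim :: "('a, 'b) ring_scheme \<Rightarrow> enat" where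
  "krull_dim R = (SUP n \<in> {n. \<exists>P. (\<forall>i\<le>n. primeideal (P i) R) \<and> (\<forall>i<n. P i \<subset> P (Suc i))}. enat n)"

definition ideal_radical :: "('a, 'b) ring_scheme \<Rightarrow> 'a set \<Rightarrow> 'a set" where
  "ideal_radical R I = {a \<in> carrier R. \<exists>n::nat. a [^]\<^bsub>R\<^esub> n \<in> I}"

text \<open>
  For \<open>R\<close> local with maximal ideal \<open>m\<close>, the last conjunct says that the radical of
  \<open>(x\<^sub>1, \<dots>, x\<^sub>d)\<close> is \<open>m\<close>, that is, that this ideal is \<open>m\<close>-primary.
\<close>

definition system_of_parameters :: "('a, 'b) ring_scheme \<Rightarrow> nat \<Rightarrow> (nat \<Rightarrow> 'a) \<Rightarrow> bool" where
  "system_of_parameters R d x \<longleftrightarrow>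
     krull_dim R = enat d \<and> x ` {..<d} \<subseteq> carrier R \<and>
     maximalideal (ideal_radical R (Idl\<^bsub>R\<^esub> (x ` {..<d}))) R"

section \<open>The absolute integral closure\<close>

definition to_abs_closure :: "'a::idom \<Rightarrow> 'a fract alg_closure" where
  "to_abs_closure r = to_ac (to_fract r)"

definition integral_over_base :: "'a::idom fract alg_closure \<Rightarrow> bool" where
  "integral_over_base z \<longleftrightarrow>
     (\<exists>p :: 'a poly. Polynomial.lead_coeff p = 1 \<and> poly (map_poly to_abs_closure p) z = 0)"

definition Rplus :: "'a::idom fract alg_closure ring" where
  "Rplus = ring_of_type_algebra\<lparr>carrier := {z. integral_over_base z}\<rparr>"

section \<open>Top local cohomology as a direct limit\<close>

definition power_ideal :: "('a, 'b) ring_scheme \<Rightarrow> nat \<Rightarrow> (nat \<Rightarrow> 'a) \<Rightarrow> nat \<Rightarrow> 'a set" where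
  "power_ideal A d z n = Idl\<^bsub>A\<^esub> ((\<lambda>i. z i [^]\<^bsub>A\<^esub> n) ` {..<d})"

text \<open>
  The transition map from level \<open>n\<close> to level \<open>k \<ge> n\<close>, which sends the residue class of \<open>r\<close> to that of
  \<open>(z\<^sub>1 \<cdots> z\<^sub>d)\<^sup>k\<^sup>-\<^sup>n r\<close>.  All elements \<open>r\<close> of a coset \<open>C\<close> contribute the same coset to the union.
\<close>

definition lc_transition ::
    "('a, 'b) ring_scheme \<Rightarrow> nat \<Rightarrow> (nat \<Rightarrow> 'a) \<Rightarrow> nat \<Rightarrow> nat \<Rightarrow> 'a set \<Rightarrow> 'a set" where
  "lc_transition A d z n k C =
     (\<Union>r\<in>C. power_ideal A d z k +>\<^bsub>A\<^esub> (finprod A z {..<d} [^]\<^bsub>A\<^esub> (k - n) \<otimes>\<^bsub>A\<^esub> r))"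

definition lc_pairs :: "('a, 'b) ring_scheme \<Rightarrow> nat \<Rightarrow> (nat \<Rightarrow> 'a) \<Rightarrow> (nat \<times> 'a set) set" where
  "lc_pairs A d z = (SIGMA n:{1..}. carrier (A Quot power_ideal A d z n))"

definition lc_rel ::
    "('a, 'b) ring_scheme \<Rightarrow> nat \<Rightarrow> (nat \<Rightarrow> 'a) \<Rightarrow> ((nat \<times> 'a set) \<times> (nat \<times> 'a set)) set" where
  "lc_rel A d z =
     {((n, C), (m, C')). (n, C) \<in> lc_pairs A d z \<and> (m, C') \<in> lc_pairs A d z \<and>
        (\<exists>k. n \<le> k \<and> m \<le> k \<and> lc_transition A d z n k C = lc_transition A d z m k C')}"

text \<open>The underlying set of \<open>H\<^sup>d(A)\<close> with support in \<open>(z\<^sub>1, \<dots>, z\<^sub>d)\<close>.\<close>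

definition local_cohomology ::
    "('a, 'b) ring_scheme \<Rightarrow> nat \<Rightarrow> (nat \<Rightarrow> 'a) \<Rightarrow> (nat \<times> 'a set) set set" where
  "local_cohomology A d z = lc_pairs A d z // lc_rel A d z"

text \<open>The class \<open>[r / (z\<^sub>1\<^sup>n \<cdots> z\<^sub>d\<^sup>n)]\<close>.\<close>

definition lc_class ::
    "('a, 'b) ring_scheme \<Rightarrow> nat \<Rightarrow> (nat \<Rightarrow> 'a) \<Rightarrow> nat \<Rightarrow> 'a \<Rightarrow> (nat \<times> 'a set) set" where
  "lc_class A d z n r = lc_rel A d z `` {(n, power_ideal A d z n +>\<^bsub>A\<^esub> r)}"

section \<open>The absolute integral closure as coefficients, and the natural map\<close>

definition H_plus ::
    "nat \<Rightarrow> (nat \<Rightarrow> 'a::idom) \<Rightarrow> (nat \<times> 'a fract alg_closure set) set set" where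
  "H_plus d x = local_cohomology Rplus d (\<lambda>i. to_abs_closure (x i))"

definition H_plus_class ::
    "nat \<Rightarrow> (nat \<Rightarrow> 'a::idom) \<Rightarrow> nat \<Rightarrow> 'a fract alg_closure \<Rightarrow> (nat \<times> 'a fract alg_closure set) set"
  where "H_plus_class d x n r = lc_class Rplus d (\<lambda>i. to_abs_closure (x i)) n r"

text \<open>
  The value of the natural map at \<open>u\<close> is the class obtained from any choice of \<open>n\<close>, \<open>r\<close>, \<open>s\<close>, \<open>B\<close>;
  the definite description relies on its independence of these choices.
\<close>

definition Phi ::
    "nat \<Rightarrow> (nat \<Rightarrow> 'a::idom) \<Rightarrow> (nat \<Rightarrow> 'a) \<Rightarrow>
     (nat \<times> 'a fract alg_closure set) set \<Rightarrow> (nat \<times> 'a fract alg_closure set) set" where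
  "Phi d x y u = (THE v. \<exists>n r s B.
     1 \<le> n \<and> r \<in> carrier Rplus \<and> u = H_plus_class d x n r \<and>
     1 \<le> s \<and> B \<in> carrier_mat d d \<and> (\<forall>i<d. y i ^ s = (\<Sum>j<d. B $$ (i, j) * x j ^ n)) \<and>
     v = H_plus_class d y s (r * to_abs_closure (det B)))"

end

theory Submission
  imports Defs "Jordan_Normal_Form.Char_Poly"
begin

text \<open>
  The ideals \<open>(x)\<close> and \<open>(y)\<close> have the same radical, the maximal ideal of \<open>R\<close>.  So, besides the
  relations \<open>y\<^sup>s = B x\<^sup>n\<close> that define \<open>\<Phi>\<close>, there are relations \<open>x\<^sup>N = E y\<^sup>s\<close> in the opposite
  direction (powers of sequences are taken entrywise), and the map that they define undoes \<open>\<Phi>\<close>: the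
  composite multiplies the class of \<open>r\<close> by \<open>det (E B)\<close>, where \<open>x\<^sup>N = (E B) x\<^sup>n\<close>.  Such a product may be
  computed with any other matrix that carries \<open>x\<^sup>n\<close> to a power of \<open>x\<close>, for example the identity
  matrix, so the composite is the identity.

  All of this rests on one fact, \<open>det_independent_same_target\<close>: if \<open>A x = A' x = z\<close>, then
  \<open>z\<^sub>1 \<cdots> z\<^sub>d (det A - det A')\<close> lies in \<open>(z\<^sub>1\<^sup>2, \<dots>, z\<^sub>d\<^sup>2)\<close>.  It says that the class of the determinant
  in the direct limit does not depend on the matrix (\<open>det_class_independent\<close>).  It yields both that
  \<open>\<Phi>\<close> is well defined (\<open>comparison_well_defined\<close>), which is required to evaluate the definite
  description in its definition, and the injectivity (\<open>comparison_injective\<close>), where the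
  well-definedness is applied to the map from \<open>y\<close> back to \<open>x\<close>.

  These arguments work over any commutative ring of coefficients that contains the image of \<open>R\<close>.
  That \<open>R\<^sup>+\<close> is such a ring, that is, that sums and products of integral elements are integral,
  follows from the determinant trick: an element is integral as soon as multiplication by it
  preserves a nonzero finitely generated submodule of the field.
\<close>

section \<open>Ideals spanned by a finite sequence\<close>

text \<open>
  The ideal of the ring \<open>S\<close> that is generated by \<open>f\<^sub>0, \<dots>, f\<^bsub>d-1\<^esub>\<close>.  The coefficients are confined to a
  subset of a type, so that \<open>R\<close> (where \<open>S\<close> is \<open>UNIV\<close>) and \<open>R\<^sup>+\<close> are handled alike.
\<close>

definition ideal_span :: "'a::comm_ring_1 set \<Rightarrow> nat \<Rightarrow> (nat \<Rightarrow> 'a) \<Rightarrow> 'a set" where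
  "ideal_span S d f = {a. \<exists>c. (\<forall>i<d. c i \<in> S) \<and> a = (\<Sum>i<d. c i * f i)}"

lemma ideal_span_UNIV_iff: "a \<in> ideal_span UNIV d f \<longleftrightarrow> (\<exists>c. a = (\<Sum>i<d. c i * f i))"
  by (simp add: ideal_span_def)

locale type_subring =
  fixes S :: "'b::comm_ring_1 set"
  assumes one_mem: "1 \<in> S"
    and uminus_mem: "a \<in> S \<Longrightarrow> - a \<in> S"
    and add_mem: "a \<in> S \<Longrightarrow> b \<in> S \<Longrightarrow> a + b \<in> S"
    and mult_mem: "a \<in> S \<Longrightarrow> b \<in> S \<Longrightarrow> a * b \<in> S"
begin

lemma zero_mem: "0 \<in> S"
  using add_mem[OF one_mem uminus_mem[OF one_mem]] by simp

lemma power_mem: "a \<in> S \<Longrightarrow> a ^ n \<in> S"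
  by (induction n) (auto simp: one_mem mult_mem)

lemma sum_mem: "(\<And>i. i \<in> I \<Longrightarrow> f i \<in> S) \<Longrightarrow> sum f I \<in> S"
  by (induction I rule: infinite_finite_induct) (auto simp: zero_mem add_mem)

lemma prod_mem: "(\<And>i. i \<in> I \<Longrightarrow> f i \<in> S) \<Longrightarrow> prod f I \<in> S"
  by (induction I rule: infinite_finite_induct) (auto simp: one_mem mult_mem)

lemma ideal_span_add: "a \<in> ideal_span S d f \<Longrightarrow> b \<in> ideal_span S d f \<Longrightarrow> a + b \<in> ideal_span S d f"
  unfolding ideal_span_def mem_Collect_eq
proof (elim exE conjE)
  fix c e assume "\<forall>i<d. c i \<in> S" "a = (\<Sum>i<d. c i * f i)"
    "\<forall>i<d. e i \<in> S" "b = (\<Sum>i<d. e i * f i)"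
  then show "\<exists>c. (\<forall>i<d. c i \<in> S) \<and> a + b = (\<Sum>i<d. c i * f i)"
    by (intro exI[of _ "\<lambda>i. c i + e i"]) (auto simp: add_mem distrib_right sum.distrib)
qed

lemma ideal_span_mult: "a \<in> S \<Longrightarrow> b \<in> ideal_span S d f \<Longrightarrow> a * b \<in> ideal_span S d f"
  unfolding ideal_span_def mem_Collect_eq
proof (elim exE conjE)
  fix c assume "a \<in> S" "\<forall>i<d. c i \<in> S" "b = (\<Sum>i<d. c i * f i)"
  then show "\<exists>c. (\<forall>i<d. c i \<in> S) \<and> a * b = (\<Sum>i<d. c i * f i)"
    by (intro exI[of _ "\<lambda>i. a * c i"]) (auto simp: mult_mem sum_distrib_left mult.assoc)
qed

lemma ideal_span_zero: "0 \<in> ideal_span S d f"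
  unfolding ideal_span_def using zero_mem by (auto intro!: exI[of _ "\<lambda>_. 0"])

lemma ideal_span_uminus: "a \<in> ideal_span S d f \<Longrightarrow> - a \<in> ideal_span S d f"
  using ideal_span_mult[of "- 1"] uminus_mem[OF one_mem] by fastforce

lemma ideal_span_diff:
  "a \<in> ideal_span S d f \<Longrightarrow> b \<in> ideal_span S d f \<Longrightarrow> a - b \<in> ideal_span S d f"
  using ideal_span_add[of a d f "- b"] ideal_span_uminus by simp

lemma ideal_span_sum:
  "(\<And>i. i \<in> I \<Longrightarrow> g i \<in> ideal_span S d f) \<Longrightarrow> sum g I \<in> ideal_span S d f"
  by (induction I rule: infinite_finite_induct) (auto simp: ideal_span_zero ideal_span_add)

lemma ideal_span_generator: "i < d \<Longrightarrow> f i \<in> ideal_span S d f"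
  unfolding ideal_span_def
proof (intro CollectI exI conjI)
  assume i: "i < d"
  show "\<forall>k<d. (if k = i then 1 else 0) \<in> S" by (auto simp: one_mem zero_mem)
  have "(\<Sum>k<d. (if k = i then 1 else 0) * f k) = (\<Sum>k<d. if k = i then f k else 0)"
    by (intro sum.cong) auto
  then show "f i = (\<Sum>k<d. (if k = i then 1 else 0) * f k)" using i by simp
qed

lemma ideal_span_subset: "(\<And>i. i < d \<Longrightarrow> f i \<in> S) \<Longrightarrow> ideal_span S d f \<subseteq> S"
  unfolding ideal_span_def by (auto intro!: sum_mem mult_mem)

end

lemma type_subring_UNIV: "type_subring UNIV"
  by unfold_locales auto

interpretation full: type_subring "UNIV :: 'a::comm_ring_1 set"
  by (rule type_subring_UNIV)

text \<open>
  By induction on the number of generators: if \<open>b\<^sup>M\<close> lies in the ideal of the \<open>k\<close>-th powers of the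
  first \<open>d\<close> generators, then each term of the binomial expansion of \<open>(b + c x\<^sub>d)\<^bsup>M+k\<^esup>\<close> contains
  \<open>b\<^sup>M\<close> or \<open>x\<^sub>d\<^sup>k\<close>.
\<close>

lemma power_in_ideal_of_powers:
  fixes x :: "nat \<Rightarrow> 'a::comm_ring_1"
  assumes "a \<in> ideal_span UNIV d x"
  shows "\<exists>N. a ^ N \<in> ideal_span UNIV d (\<lambda>i. x i ^ k)"
  using assms
proof (induction d arbitrary: a)
  case 0
  then show ?case by (auto simp: ideal_span_def intro: exI[of _ 1])
next
  case (Suc d)
  from Suc.prems obtain c where a: "a = (\<Sum>i<d. c i * x i) + c d * x d"
    by (auto simp: ideal_span_def)
  define b where "b = (\<Sum>i<d. c i * x i)"
  obtain M where M: "b ^ M \<in> ideal_span UNIV d (\<lambda>i. x i ^ k)"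
    using Suc.IH[of b] by (auto simp: ideal_span_def b_def)
  let ?J = "ideal_span UNIV (Suc d) (\<lambda>i. x i ^ k)"
  have "b ^ M \<in> ?J"
  proof -
    from M obtain e where "b ^ M = (\<Sum>i<d. e i * x i ^ k)" by (auto simp: ideal_span_def)
    then show ?thesis by (auto simp: ideal_span_UNIV_iff intro!: exI[of _ "\<lambda>i. if i < d then e i else 0"])
  qed
  have "of_nat ((M + k) choose j) * b ^ j * (c d * x d) ^ (M + k - j) \<in> ?J" if "j \<le> M + k" for j
  proof (cases "M \<le> j")
    case True
    then have "b ^ j = b ^ (j - M) * b ^ M" by (simp flip: power_add)
    then have "b ^ j \<in> ?J" using full.ideal_span_mult[OF UNIV_I \<open>b ^ M \<in> ?J\<close>] by metis
    from full.ideal_span_mult[OF UNIV_I this, of "of_nat ((M + k) choose j) * (c d * x d) ^ (M + k - j)"]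
    show ?thesis by (simp add: mult_ac)
  next
    case False
    then have "M + k - j = k + (M - j)" by simp
    then have "(c d * x d) ^ (M + k - j) = (c d) ^ (M + k - j) * x d ^ (M - j) * x d ^ k"
      by (simp add: power_mult_distrib power_add mult_ac)
    moreover have "x d ^ k \<in> ?J"
      using full.ideal_span_generator[of d "Suc d" "\<lambda>i. x i ^ k"] by simp
    ultimately show ?thesis using full.ideal_span_mult[of _ "x d ^ k"]
      by (metis UNIV_I mult.assoc)
  qed
  then have "a ^ (M + k) \<in> ?J"
    unfolding a b_def[symmetric] binomial_ring by (intro full.ideal_span_sum) auto
  then show ?case by blast
qed

section \<open>Determinants of matrices that carry one sequence to another\<close>

definition transforms :: "nat \<Rightarrow> 'a::comm_ring_1 mat \<Rightarrow> (nat \<Rightarrow> 'a) \<Rightarrow> (nat \<Rightarrow> 'a) \<Rightarrow> bool" where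
  "transforms d B x z \<longleftrightarrow> B \<in> carrier_mat d d \<and> (\<forall>i<d. z i = (\<Sum>j<d. B $$ (i, j) * x j))"

lemma transforms_mult:
  assumes "transforms d B x z" "transforms d E z w"
  shows "transforms d (E * B) x w"
proof -
  have B: "B \<in> carrier_mat d d" and E: "E \<in> carrier_mat d d"
    using assms by (auto simp: transforms_def)
  have "w i = (\<Sum>j<d. (E * B) $$ (i, j) * x j)" if i: "i < d" for i
  proof -
    have "w i = (\<Sum>k<d. E $$ (i, k) * (\<Sum>j<d. B $$ (k, j) * x j))"
      using assms i by (simp add: transforms_def)
    also have "\<dots> = (\<Sum>j<d. \<Sum>k<d. E $$ (i, k) * B $$ (k, j) * x j)"
      by (subst sum.swap) (simp add: sum_distrib_left mult.assoc)
    also have "\<dots> = (\<Sum>j<d. (E * B) $$ (i, j) * x j)"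
      using B E i by (intro sum.cong)
        (auto simp: scalar_prod_def sum_distrib_right atLeast0LessThan)
    finally show ?thesis .
  qed
  then show ?thesis using B E by (simp add: transforms_def)
qed

lemma transforms_diag: "transforms d (mat_diag d f) x (\<lambda>i. f i * x i)"
proof -
  have "(\<Sum>j<d. mat_diag d f $$ (i, j) * x j) = f i * x i" if "i < d" for i
  proof -
    have "(\<Sum>j<d. mat_diag d f $$ (i, j) * x j) = (\<Sum>j<d. if i = j then f j * x j else 0)"
      using that by (intro sum.cong) (auto simp: mat_diag_def)
    then show ?thesis using that by simp
  qed
  then show ?thesis by (simp add: transforms_def)
qed

lemma transforms_one: "transforms d (1\<^sub>m d) x x"
  using transforms_diag[of d "\<lambda>_. 1" x] by (simp add: mat_diag_one)

lemma det_mat_diag: "det (mat_diag d f) = (\<Prod>i<d. f i :: 'a::comm_ring_1)"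
proof -
  have "det (mat_diag d f) = prod_list (diag_mat (mat_diag d f))"
    by (rule det_upper_triangular[where n = d]) (auto simp: mat_diag_def)
  also have "diag_mat (mat_diag d f) = map f [0..<d]"
    by (auto simp: diag_mat_def mat_diag_def)
  finally show ?thesis
    by (simp add: prod.list_conv_set_nth atLeast0LessThan)
qed

text \<open>
  Cramer's rule: multiply \<open>M x = w\<close> by the adjugate of \<open>M\<close>.  It shows in particular that
  \<open>det M\<close> maps the ideal \<open>(x)\<close> into the ideal \<open>(w)\<close>.
\<close>

lemma det_times_transformed:
  assumes "transforms d M x w" "j < d"
  shows "det M * x j = (\<Sum>k<d. adj_mat M $$ (j, k) * w k)"
proof -
  have M: "M \<in> carrier_mat d d" using assms by (simp add: transforms_def)
  have "transforms d (adj_mat M) w (\<lambda>i. det M * x i)"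
  proof -
    have "transforms d (adj_mat M * M) x (\<lambda>i. det M * x i)"
    proof -
      have "adj_mat M * M = mat_diag d (\<lambda>_. det M)"
        using adj_mat(3)[OF M] by (auto simp: mat_diag_def)
      then show ?thesis using transforms_diag[of d "\<lambda>_. det M" x] by simp
    qed
    moreover have "transforms d (adj_mat M) w (\<lambda>i. \<Sum>k<d. adj_mat M $$ (i, k) * w k)"
      using adj_mat(1)[OF M] by (simp add: transforms_def)
    from transforms_mult[OF assms(1) this]
    have "transforms d (adj_mat M * M) x (\<lambda>i. \<Sum>k<d. adj_mat M $$ (i, k) * w k)" .
    ultimately show ?thesis using adj_mat(1)[OF M] by (simp add: transforms_def)
  qed
  then show ?thesis using assms(2) by (simp add: transforms_def)
qed

text \<open>
  The determinant is linear in row \<open>i\<close>, and the cofactors along this row do not involve the row.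
\<close>

lemma det_difference_of_one_row:
  fixes A A' :: "'a::comm_ring_1 mat"
  assumes A: "A \<in> carrier_mat d d" "A' \<in> carrier_mat d d" and i: "i < d"
    and eq: "\<And>k j. k < d \<Longrightarrow> j < d \<Longrightarrow> k \<noteq> i \<Longrightarrow> A $$ (k, j) = A' $$ (k, j)"
  shows "det A - det A' =
    det (mat d d (\<lambda>(k, j). if k = i then A $$ (i, j) - A' $$ (i, j) else A $$ (k, j)))"
    (is "_ = det ?D")
proof -
  have del: "mat_delete ?D i j = mat_delete A i j" "mat_delete A' i j = mat_delete A i j"
    if "j < d" for j
    using A i eq that by (auto intro!: eq_matI simp: mat_delete_def)
  have "det A = (\<Sum>j<d. A $$ (i, j) * cofactor A i j)"
    by (rule laplace_expansion_row[OF A(1) i])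
  moreover have "det A' = (\<Sum>j<d. A' $$ (i, j) * cofactor A i j)"
    using laplace_expansion_row[OF A(2) i] del by (auto simp: cofactor_def)
  moreover have "det ?D = (\<Sum>j<d. (A $$ (i, j) - A' $$ (i, j)) * cofactor A i j)"
    using laplace_expansion_row[of ?D d, OF _ i] del i by (auto simp: cofactor_def)
  ultimately show ?thesis by (simp add: sum_subtractf left_diff_distrib)
qed

text \<open>
  The difference of the determinants is \<open>det D\<close>, where the row \<open>i\<close> of \<open>D\<close> is the difference of the
  two rows.  That row annihilates \<open>x\<close>, so \<open>D x\<close> is \<open>z\<close> with the entry \<open>z\<^sub>i\<close> replaced by \<open>0\<close>, and
  Cramer's rule puts every \<open>det D * x\<^sub>j\<close>, hence also \<open>det D * z\<^sub>i\<close>, in the ideal of the \<open>z\<^sub>k\<close> with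
  \<open>k \<noteq> i\<close>.  Multiplication by the other factors \<open>z\<^sub>k\<close> of the product turns each of these generators
  into a multiple of its square.
\<close>

lemma det_independent_one_row:
  fixes A A' :: "'a::comm_ring_1 mat"
  assumes "transforms d A x z" "transforms d A' x z" and i: "i < d"
    and eq: "\<And>k j. k < d \<Longrightarrow> j < d \<Longrightarrow> k \<noteq> i \<Longrightarrow> A $$ (k, j) = A' $$ (k, j)"
  shows "(\<Prod>k<d. z k) * (det A - det A') \<in> ideal_span UNIV d (\<lambda>k. z k ^ 2)"
proof -
  define D where "D = mat d d (\<lambda>(k, j). if k = i then A $$ (i, j) - A' $$ (i, j) else A $$ (k, j))"
  have A: "A \<in> carrier_mat d d" "A' \<in> carrier_mat d d"
    and z: "\<And>k. k < d \<Longrightarrow> z k = (\<Sum>j<d. A $$ (k, j) * x j)"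
    and z': "\<And>k. k < d \<Longrightarrow> z k = (\<Sum>j<d. A' $$ (k, j) * x j)"
    using assms by (auto simp: transforms_def)
  have det: "det A - det A' = det D"
    unfolding D_def by (rule det_difference_of_one_row[OF A i eq])
  have D: "transforms d D x (z(i := 0))"
  proof -
    have "(\<Sum>j<d. D $$ (i, j) * x j) = z i - z i"
      using i by (subst (1) z[OF i], subst z'[OF i])
        (simp add: D_def left_diff_distrib sum_subtractf)
    moreover have "(\<Sum>j<d. D $$ (k, j) * x j) = z k" if "k < d" "k \<noteq> i" for k
      using that z by (simp add: D_def)
    ultimately show ?thesis by (auto simp: transforms_def D_def)
  qed
  define g where "g k = (\<Sum>j<d. A $$ (i, j) * adj_mat D $$ (j, k))" for k
  have "det D * z i = (\<Sum>j<d. A $$ (i, j) * (det D * x j))"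
    by (subst z[OF i]) (simp add: sum_distrib_left mult_ac)
  also have "\<dots> = (\<Sum>j<d. \<Sum>k<d. A $$ (i, j) * adj_mat D $$ (j, k) * (z(i := 0)) k)"
    using det_times_transformed[OF D] by (simp add: sum_distrib_left mult.assoc)
  also have "\<dots> = (\<Sum>k<d. g k * (z(i := 0)) k)"
    by (subst sum.swap) (simp add: g_def sum_distrib_right)
  finally have gz: "det D * z i = (\<Sum>k<d. g k * (z(i := 0)) k)" .
  have "(\<Prod>k<d. z k) * det D = (\<Prod>k\<in>{..<d} - {i}. z k) * (det D * z i)"
    using i by (subst prod.remove[of _ i]) (auto simp: mult_ac)
  also have "\<dots> = (\<Sum>k<d. (if k = i then 0 else g k * (\<Prod>l\<in>{..<d} - {i} - {k}. z l)) * z k ^ 2)"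
    unfolding gz sum_distrib_left
  proof (rule sum.cong[OF refl])
    fix k assume k: "k \<in> {..<d}"
    show "(\<Prod>k\<in>{..<d} - {i}. z k) * (g k * (z(i := 0)) k) =
      (if k = i then 0 else g k * (\<Prod>l\<in>{..<d} - {i} - {k}. z l)) * z k ^ 2"
    proof (cases "k = i")
      case False
      then have "(\<Prod>k\<in>{..<d} - {i}. z k) = z k * (\<Prod>l\<in>{..<d} - {i} - {k}. z l)"
        using k by (intro prod.remove) auto
      with False show ?thesis by (simp add: power2_eq_square mult_ac)
    qed simp
  qed
  finally show ?thesis
    unfolding det ideal_span_UNIV_iff
    by (intro exI[of _ "\<lambda>k. if k = i then 0 else g k * (\<Prod>l\<in>{..<d} - {i} - {k}. z l)"])
qed

text \<open>
  The rows of \<open>A\<close> are replaced by those of \<open>A'\<close> one at a time; every intermediate matrix still carries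
  \<open>x\<close> to \<open>z\<close>.
\<close>

lemma det_independent_same_target:
  fixes A A' :: "'a::comm_ring_1 mat"
  assumes "transforms d A x z" "transforms d A' x z"
  shows "(\<Prod>k<d. z k) * (det A - det A') \<in> ideal_span UNIV d (\<lambda>k. z k ^ 2)"
proof -
  define M where "M m = mat d d (\<lambda>(k, j). if k < m then A' $$ (k, j) else A $$ (k, j))" for m
  have A: "A \<in> carrier_mat d d" "A' \<in> carrier_mat d d"
    using assms by (auto simp: transforms_def)
  have M: "transforms d (M m) x z" for m
    unfolding transforms_def
  proof (intro conjI allI impI)
    fix i assume "i < d"
    then show "z i = (\<Sum>j<d. M m $$ (i, j) * x j)"
      using assms by (cases "i < m") (simp_all add: transforms_def M_def)
  qed (simp add: M_def)
  have "(\<Prod>k<d. z k) * (det (M 0) - det (M m)) \<in> ideal_span UNIV d (\<lambda>k. z k ^ 2)"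
    if "m \<le> d" for m
    using that
  proof (induction m)
    case 0
    then show ?case by (simp add: full.ideal_span_zero)
  next
    case (Suc m)
    have "(\<Prod>k<d. z k) * (det (M m) - det (M (Suc m))) \<in> ideal_span UNIV d (\<lambda>k. z k ^ 2)"
      using Suc.prems by (intro det_independent_one_row[OF M M, of m]) (auto simp: M_def)
    from full.ideal_span_add[OF Suc.IH this] Suc.prems show ?case
      by (simp add: algebra_simps)
  qed
  from this[of d] have "(\<Prod>k<d. z k) * (det (M 0) - det (M d)) \<in> ideal_span UNIV d (\<lambda>k. z k ^ 2)"
    by simp
  moreover have "M 0 = A" "M d = A'" using A by (auto simp: M_def)
  ultimately show ?thesis by simp
qed

text \<open>
  The fractions \<open>det B / y\<^sup>s\<close> and \<open>det B' / y\<^bsup>s'\<^esup>\<close> agree in the direct limit.  Scaling the rows of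
  \<open>B\<close> by \<open>y\<^sub>i\<^bsup>s'\<^esup>\<close> and those of \<open>B'\<close> by \<open>y\<^sub>i\<^sup>s\<close> gives both matrices the target \<open>y\<^bsup>s+s'\<^esup>\<close>, and the
  squares in the previous lemma lead to the level \<open>2 (s + s')\<close>.
\<close>

lemma det_independent:
  fixes B B' :: "'a::comm_ring_1 mat"
  assumes "transforms d B w (\<lambda>i. y i ^ s)" "transforms d B' w (\<lambda>i. y i ^ s')"
  shows "\<exists>k\<ge>s. s' \<le> k \<and>
    (\<Prod>i<d. y i) ^ (k - s) * det B - (\<Prod>i<d. y i) ^ (k - s') * det B'
      \<in> ideal_span UNIV d (\<lambda>i. y i ^ k)"
proof -
  let ?P = "\<Prod>i<d. y i" and ?z = "\<lambda>i. y i ^ (s + s')"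
  have B: "B \<in> carrier_mat d d" "B' \<in> carrier_mat d d"
    using assms by (auto simp: transforms_def)
  have "transforms d (mat_diag d (\<lambda>i. y i ^ s') * B) w ?z"
    using transforms_mult[OF assms(1) transforms_diag[of d "\<lambda>i. y i ^ s'"]]
    by (simp add: power_add mult_ac)
  moreover have "transforms d (mat_diag d (\<lambda>i. y i ^ s) * B') w ?z"
    using transforms_mult[OF assms(2) transforms_diag[of d "\<lambda>i. y i ^ s"]]
    by (simp add: power_add mult_ac)
  ultimately have "(\<Prod>i<d. ?z i) *
      (det (mat_diag d (\<lambda>i. y i ^ s') * B) - det (mat_diag d (\<lambda>i. y i ^ s) * B'))
      \<in> ideal_span UNIV d (\<lambda>k. ?z k ^ 2)"
    by (rule det_independent_same_target)
  also have "(\<Prod>i<d. ?z i) *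
      (det (mat_diag d (\<lambda>i. y i ^ s') * B) - det (mat_diag d (\<lambda>i. y i ^ s) * B')) =
    ?P ^ (s + s') * (?P ^ s' * det B - ?P ^ s * det B')"
    using B by (simp add: det_mult[of _ d] det_mat_diag prod_power_distrib)
  also have "\<dots> = ?P ^ (2 * (s + s') - s) * det B - ?P ^ (2 * (s + s') - s') * det B'"
  proof -
    have "2 * (s + s') - s = s + s' + s'" "2 * (s + s') - s' = s + s' + s" by auto
    then show ?thesis by (simp only: power_add) (simp add: algebra_simps)
  qed
  finally show ?thesis
    by (intro exI[of _ "2 * (s + s')"]) (auto simp: power_mult[symmetric] mult.commute)
qed

text \<open>
  Provides the matrices that enter the definition of \<open>\<Phi>\<close>, for every exponent \<open>k\<close> of \<open>x\<close>.
\<close>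

lemma common_power_transforms:
  fixes x y :: "nat \<Rightarrow> 'a::comm_ring_1"
  assumes "\<And>i. i < d \<Longrightarrow> \<exists>e. y i ^ e \<in> ideal_span UNIV d x"
  shows "\<exists>t\<ge>1. \<exists>C. transforms d C (\<lambda>i. x i ^ k) (\<lambda>i. y i ^ t)"
proof -
  let ?J = "ideal_span UNIV d (\<lambda>i. x i ^ k)"
  have "\<exists>N. y i ^ N \<in> ?J" if i: "i < d" for i
    using assms[OF i] power_in_ideal_of_powers[of _ d x k] by (metis power_mult)
  then obtain N where N: "\<And>i. i < d \<Longrightarrow> y i ^ N i \<in> ?J" by metis
  \<comment> \<open>The sum bounds every \<open>N i\<close>; the summand 1 makes the exponent positive even if all \<open>N i\<close> vanish.\<close>
  define t where "t = 1 + (\<Sum>i<d. N i)"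
  have "\<exists>c. y i ^ t = (\<Sum>j<d. c j * x j ^ k)" if i: "i < d" for i
  proof -
    have "N i \<le> (\<Sum>i<d. N i)" using i by (intro member_le_sum) auto
    then have "y i ^ t = y i ^ (t - N i) * y i ^ N i" by (simp add: t_def flip: power_add)
    also have "\<dots> \<in> ?J" using N[OF i] by (intro full.ideal_span_mult) auto
    finally show ?thesis by (simp add: ideal_span_UNIV_iff)
  qed
  then obtain c where "\<And>i. i < d \<Longrightarrow> y i ^ t = (\<Sum>j<d. c i j * x j ^ k)" by metis
  then have "transforms d (mat d d (\<lambda>(i, j). c i j)) (\<lambda>i. x i ^ k) (\<lambda>i. y i ^ t)"
    by (simp add: transforms_def)
  then show ?thesis by (intro exI[of _ t]) (auto simp: t_def)
qed

section \<open>Fractions in the direct limit\<close>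

lemma ring_of_type_algebra_simps [simp]:
  "carrier ring_of_type_algebra = UNIV" "a \<otimes>\<^bsub>ring_of_type_algebra\<^esub> b = a * b"
  "a \<oplus>\<^bsub>ring_of_type_algebra\<^esub> b = a + b"
  "\<one>\<^bsub>ring_of_type_algebra\<^esub> = 1" "\<zero>\<^bsub>ring_of_type_algebra\<^esub> = 0"
  by (simp_all add: ring_of_type_algebra_def)

context type_subring
begin

text \<open>
  The subring as a record with carrier, in the form in which \<^const>\<open>Rplus\<close> is given.
\<close>

abbreviation A :: "'b ring" where
  "A \<equiv> ring_of_type_algebra\<lparr>carrier := S\<rparr>"

lemma cring_A: "cring A"
proof (rule cringI)
  show "abelian_group A"
  proof (rule abelian_groupI)
    fix a assume "a \<in> carrier A"
    then show "\<exists>b\<in>carrier A. b \<oplus>\<^bsub>A\<^esub> a = \<zero>\<^bsub>A\<^esub>"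
      using uminus_mem by (intro bexI[of _ "- a"]) auto
  qed (auto simp: add_mem zero_mem algebra_simps)
  show "Group.comm_monoid A"
    by (rule comm_monoidI) (auto simp: mult_mem one_mem algebra_simps)
qed (simp add: algebra_simps)

lemma A_pow: "a [^]\<^bsub>A\<^esub> (n::nat) = a ^ n"
proof -
  interpret cring A by (rule cring_A)
  show ?thesis by (induction n) (simp_all add: mult.commute)
qed

lemma A_finprod: "finite I \<Longrightarrow> (\<And>i. i \<in> I \<Longrightarrow> f i \<in> S) \<Longrightarrow> finprod A f I = prod f I"
proof -
  interpret cring A by (rule cring_A)
  show "finite I \<Longrightarrow> (\<And>i. i \<in> I \<Longrightarrow> f i \<in> S) \<Longrightarrow> finprod A f I = prod f I"
  proof (induction I rule: finite_induct)
    case (insert i I)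
    then have "f \<in> I \<rightarrow> carrier A" "f i \<in> carrier A" by auto
    from finprod_insert[OF insert.hyps this] insert show ?case by simp
  qed simp
qed

lemma Idl_eq_ideal_span:
  assumes "\<And>i. i < d \<Longrightarrow> f i \<in> S"
  shows "Idl\<^bsub>A\<^esub> (f ` {..<d}) = ideal_span S d f"
proof
  interpret cring A by (rule cring_A)
  have right: "a * b \<in> ideal_span S d f" if "a \<in> ideal_span S d f" "b \<in> S" for a b
    using ideal_span_mult[OF that(2,1)] by (simp add: mult.commute)
  have "ideal (ideal_span S d f) A"
  proof (rule idealI)
    show "subgroup (ideal_span S d f) (add_monoid A)"
    proof (rule group.subgroupI[OF add.is_group])
      fix a assume a: "a \<in> ideal_span S d f"
      then have aS: "a \<in> S" "- a \<in> S"
        using ideal_span_subset[of d f, OF assms] uminus_mem by blast+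
      have "inv\<^bsub>add_monoid A\<^esub> a = - a"
        using minus_equality[of "- a" a] aS by (simp add: a_inv_def)
      then show "inv\<^bsub>add_monoid A\<^esub> a \<in> ideal_span S d f"
        using ideal_span_uminus[OF a] by simp
    next
      show "ideal_span S d f \<noteq> {}" using ideal_span_zero by blast
    qed (use ideal_span_subset[of d f, OF assms] ideal_span_add in auto)
  qed (use ring_axioms ideal_span_mult right in auto)
  then show "Idl\<^bsub>A\<^esub> (f ` {..<d}) \<subseteq> ideal_span S d f"
    by (rule genideal_minimal) (auto simp: ideal_span_generator)
  have sub: "f ` {..<d} \<subseteq> carrier A" using assms by auto
  interpret J: ideal "Idl\<^bsub>A\<^esub> (f ` {..<d})" A by (rule genideal_ideal[OF sub])
  have gen: "f i \<in> Idl\<^bsub>A\<^esub> (f ` {..<d})" if "i < d" for i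
    using genideal_self[OF sub] that by auto
  have "(\<Sum>i\<in>I. c i * f i) \<in> Idl\<^bsub>A\<^esub> (f ` {..<d})"
    if "finite I" "I \<subseteq> {..<d}" "\<forall>i<d. c i \<in> S" for c I
    using that
  proof (induction I rule: finite_induct)
    case empty
    then show ?case using J.zero_closed by simp
  next
    case (insert i I)
    then have "c i * f i \<in> Idl\<^bsub>A\<^esub> (f ` {..<d})"
      using J.I_l_closed[of "f i" "c i"] gen by auto
    then show ?case using insert J.a_closed[of "c i * f i"] by auto
  qed
  then show "ideal_span S d f \<subseteq> Idl\<^bsub>A\<^esub> (f ` {..<d})"
    by (auto simp: ideal_span_def)
qed

lemma power_ideal_eq:
  assumes "\<And>i. i < d \<Longrightarrow> z i \<in> S"
  shows "power_ideal A d z n = ideal_span S d (\<lambda>i. z i ^ n)"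
  unfolding power_ideal_def A_pow by (rule Idl_eq_ideal_span) (simp add: power_mem assms)

lemma A_coset: "I +>\<^bsub>A\<^esub> a = (\<lambda>h. h + a) ` I"
  by (auto simp: a_r_coset_def')

lemma coset_eq_iff:
  "ideal_span S d f +>\<^bsub>A\<^esub> a = ideal_span S d f +>\<^bsub>A\<^esub> b \<longleftrightarrow> a - b \<in> ideal_span S d f"
proof
  assume "ideal_span S d f +>\<^bsub>A\<^esub> a = ideal_span S d f +>\<^bsub>A\<^esub> b"
  then have "0 + a \<in> (\<lambda>h. h + b) ` ideal_span S d f"
    using ideal_span_zero unfolding A_coset by (metis image_eqI)
  then show "a - b \<in> ideal_span S d f" by auto
next
  assume ab: "a - b \<in> ideal_span S d f"
  have "h + a = (h + (a - b)) + b" "h + b = (h - (a - b)) + a" for h by simp_all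
  then show "ideal_span S d f +>\<^bsub>A\<^esub> a = ideal_span S d f +>\<^bsub>A\<^esub> b"
    unfolding A_coset using ideal_span_add[OF _ ab] ideal_span_diff[OF _ ab] by blast
qed

text \<open>
  The transition maps respect the ideals: in \<open>(z\<^sub>1 \<cdots> z\<^sub>d)\<^bsup>k-n\<^esup> z\<^sub>i\<^sup>n\<close> the factor \<open>z\<^sub>i\<close> of the product
  raises \<open>z\<^sub>i\<^sup>n\<close> to \<open>z\<^sub>i\<^sup>k\<close>.
\<close>

lemma ideal_span_raise_power:
  assumes "n \<le> k" "a \<in> ideal_span S d (\<lambda>i. z i ^ n)" "\<And>i. i < d \<Longrightarrow> z i \<in> S"
  shows "(\<Prod>i<d. z i) ^ (k - n) * a \<in> ideal_span S d (\<lambda>i. z i ^ k)"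
proof -
  obtain c where c: "\<forall>i<d. c i \<in> S" and a: "a = (\<Sum>i<d. c i * z i ^ n)"
    using assms(2) by (auto simp: ideal_span_def)
  define e where "e i = c i * (\<Prod>j\<in>{..<d} - {i}. z j) ^ (k - n)" for i
  have "(\<Prod>j<d. z j) ^ (k - n) * (c i * z i ^ n) = e i * z i ^ k" if "i < d" for i
  proof -
    have "(\<Prod>j<d. z j) = z i * (\<Prod>j\<in>{..<d} - {i}. z j)"
      using that by (intro prod.remove) auto
    moreover have "z i ^ k = z i ^ (k - n) * z i ^ n"
      using assms(1) by (simp flip: power_add)
    ultimately show ?thesis by (simp add: e_def power_mult_distrib mult_ac)
  qed
  then have "(\<Prod>i<d. z i) ^ (k - n) * a = (\<Sum>i<d. e i * z i ^ k)"
    unfolding a sum_distrib_left by simp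
  moreover have "\<forall>i<d. e i \<in> S"
    using c assms(3) by (auto simp: e_def intro!: mult_mem power_mem prod_mem)
  ultimately show ?thesis unfolding ideal_span_def by blast
qed

lemma lc_transition_coset:
  assumes "\<And>i. i < d \<Longrightarrow> z i \<in> S" "n \<le> k"
  shows "lc_transition A d z n k (power_ideal A d z n +>\<^bsub>A\<^esub> r) =
    power_ideal A d z k +>\<^bsub>A\<^esub> ((\<Prod>i<d. z i) ^ (k - n) * r)"
proof -
  let ?I = "\<lambda>n. ideal_span S d (\<lambda>i. z i ^ n)" and ?P = "\<Prod>i<d. z i"
  have "?I k +>\<^bsub>A\<^esub> (?P ^ (k - n) * r') = ?I k +>\<^bsub>A\<^esub> (?P ^ (k - n) * r)"
    if r': "r' \<in> ?I n +>\<^bsub>A\<^esub> r" for r'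
  proof -
    have "r' - r \<in> ?I n" using r' by (auto simp: A_coset)
    from ideal_span_raise_power[OF assms(2) this assms(1)] show ?thesis
      by (simp add: coset_eq_iff right_diff_distrib)
  qed
  moreover have "r \<in> ?I n +>\<^bsub>A\<^esub> r"
    using ideal_span_zero by (force simp: A_coset)
  ultimately have "(\<Union>r'\<in>?I n +>\<^bsub>A\<^esub> r. ?I k +>\<^bsub>A\<^esub> (?P ^ (k - n) * r')) = ?I k +>\<^bsub>A\<^esub> (?P ^ (k - n) * r)"
    by blast
  moreover have "finprod A z {..<d} = ?P"
    by (rule A_finprod) (auto simp: assms(1))
  ultimately show ?thesis
    using assms(1) by (simp add: lc_transition_def power_ideal_eq A_pow)
qed

text \<open>
  Equality of the fractions \<open>r / (z\<^sub>1 \<cdots> z\<^sub>d)\<^sup>n\<close> and \<open>r' / (z\<^sub>1 \<cdots> z\<^sub>d)\<^sup>m\<close> in the direct limit, expressed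
  by representatives; \<open>lc_class_eq_iff\<close> identifies it with equality of classes.
\<close>

definition eventually_equal :: "nat \<Rightarrow> (nat \<Rightarrow> 'b) \<Rightarrow> nat \<times> 'b \<Rightarrow> nat \<times> 'b \<Rightarrow> bool" where
  "eventually_equal d z = (\<lambda>(n, r) (m, r'). \<exists>k\<ge>n. m \<le> k \<and>
     (\<Prod>i<d. z i) ^ (k - n) * r - (\<Prod>i<d. z i) ^ (k - m) * r' \<in> ideal_span S d (\<lambda>i. z i ^ k))"

lemma eventually_equal_iff:
  "eventually_equal d z (n, r) (m, r') \<longleftrightarrow> (\<exists>k\<ge>n. m \<le> k \<and>
     (\<Prod>i<d. z i) ^ (k - n) * r - (\<Prod>i<d. z i) ^ (k - m) * r' \<in> ideal_span S d (\<lambda>i. z i ^ k))"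
  by (simp add: eventually_equal_def)

lemma eventually_equal_sym:
  "eventually_equal d z (n, r) (m, r') \<Longrightarrow> eventually_equal d z (m, r') (n, r)"
  unfolding eventually_equal_iff by (metis ideal_span_uminus minus_diff_eq)

lemma eventually_equal_mono:
  assumes "k \<ge> n" "k \<ge> m" "k \<le> l" "\<And>i. i < d \<Longrightarrow> z i \<in> S"
    and "(\<Prod>i<d. z i) ^ (k - n) * r - (\<Prod>i<d. z i) ^ (k - m) * r' \<in> ideal_span S d (\<lambda>i. z i ^ k)"
  shows "(\<Prod>i<d. z i) ^ (l - n) * r - (\<Prod>i<d. z i) ^ (l - m) * r' \<in> ideal_span S d (\<lambda>i. z i ^ l)"
proof -
  have "l - n = (l - k) + (k - n)" "l - m = (l - k) + (k - m)" using assms(1-3) by auto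
  then show ?thesis
    using ideal_span_raise_power[OF assms(3,5,4)]
    by (simp add: right_diff_distrib power_add mult.assoc)
qed

lemma eventually_equal_trans:
  assumes "eventually_equal d z (n, r) (m, r')" "eventually_equal d z (m, r') (q, r'')"
    and z: "\<And>i. i < d \<Longrightarrow> z i \<in> S"
  shows "eventually_equal d z (n, r) (q, r'')"
proof -
  let ?P = "\<Prod>i<d. z i"
  obtain k where k: "k \<ge> n" "k \<ge> m"
      "?P ^ (k - n) * r - ?P ^ (k - m) * r' \<in> ideal_span S d (\<lambda>i. z i ^ k)"
    using assms(1) by (auto simp: eventually_equal_iff)
  obtain l where l: "l \<ge> m" "l \<ge> q"
      "?P ^ (l - m) * r' - ?P ^ (l - q) * r'' \<in> ideal_span S d (\<lambda>i. z i ^ l)"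
    using assms(2) by (auto simp: eventually_equal_iff)
  let ?N = "max k l"
  have "?P ^ (?N - n) * r - ?P ^ (?N - m) * r' \<in> ideal_span S d (\<lambda>i. z i ^ ?N)"
    using k by (intro eventually_equal_mono[OF k(1,2) _ z k(3)]) auto
  moreover have "?P ^ (?N - m) * r' - ?P ^ (?N - q) * r'' \<in> ideal_span S d (\<lambda>i. z i ^ ?N)"
    using l by (intro eventually_equal_mono[OF l(1,2) _ z l(3)]) auto
  ultimately have "?P ^ (?N - n) * r - ?P ^ (?N - q) * r'' \<in> ideal_span S d (\<lambda>i. z i ^ ?N)"
    using ideal_span_add by fastforce
  then show ?thesis using k l by (auto simp: eventually_equal_iff intro!: exI[of _ ?N])
qed

lemma lc_pairs_iff:
  "p \<in> lc_pairs A d z \<longleftrightarrow>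
    (\<exists>n r. p = (n, power_ideal A d z n +>\<^bsub>A\<^esub> r) \<and> 1 \<le> n \<and> r \<in> S)"
  by (cases p) (auto simp: lc_pairs_def FactRing_def A_RCOSETS_def')

lemma coset_in_lc_pairs:
  "1 \<le> n \<Longrightarrow> r \<in> S \<Longrightarrow> (n, power_ideal A d z n +>\<^bsub>A\<^esub> r) \<in> lc_pairs A d z"
  by (auto simp: lc_pairs_def FactRing_def A_RCOSETS_def')

lemma lc_rel_iff:
  assumes z: "\<And>i. i < d \<Longrightarrow> z i \<in> S" and "1 \<le> n" "1 \<le> m" "r \<in> S" "r' \<in> S"
  shows "((n, power_ideal A d z n +>\<^bsub>A\<^esub> r), (m, power_ideal A d z m +>\<^bsub>A\<^esub> r')) \<in> lc_rel A d z \<longleftrightarrow>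
    eventually_equal d z (n, r) (m, r')"
proof -
  have "(n, power_ideal A d z n +>\<^bsub>A\<^esub> r) \<in> lc_pairs A d z"
      "(m, power_ideal A d z m +>\<^bsub>A\<^esub> r') \<in> lc_pairs A d z"
    using assms by (auto intro: coset_in_lc_pairs)
  moreover have "lc_transition A d z n k (power_ideal A d z n +>\<^bsub>A\<^esub> r) =
      lc_transition A d z m k (power_ideal A d z m +>\<^bsub>A\<^esub> r') \<longleftrightarrow>
      (\<Prod>i<d. z i) ^ (k - n) * r - (\<Prod>i<d. z i) ^ (k - m) * r' \<in> ideal_span S d (\<lambda>i. z i ^ k)"
    if "n \<le> k" "m \<le> k" for k
    using that z by (simp add: lc_transition_coset) (simp add: power_ideal_eq coset_eq_iff)
  ultimately show ?thesis
    by (auto simp: lc_rel_def eventually_equal_iff)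
qed

lemma equiv_lc_rel:
  assumes z: "\<And>i. i < d \<Longrightarrow> z i \<in> S"
  shows "equiv (lc_pairs A d z) (lc_rel A d z)"
proof -
  have sub: "lc_rel A d z \<subseteq> lc_pairs A d z \<times> lc_pairs A d z"
    by (auto simp: lc_rel_def)
  show ?thesis
  proof (rule equivI[OF sub])
    show "refl_on (lc_pairs A d z) (lc_rel A d z)"
      by (rule refl_onI) (auto simp: lc_rel_def)
    show "sym (lc_rel A d z)"
      by (rule symI) (auto simp: lc_rel_def eq_commute)
    show "trans (lc_rel A d z)"
    proof (rule transI)
      fix p q s assume pq: "(p, q) \<in> lc_rel A d z" and qs: "(q, s) \<in> lc_rel A d z"
      have "p \<in> lc_pairs A d z" "q \<in> lc_pairs A d z" "s \<in> lc_pairs A d z"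
        using pq qs sub by auto
      then obtain n a m b l c where p: "p = (n, power_ideal A d z n +>\<^bsub>A\<^esub> a)" "1 \<le> n" "a \<in> S"
        and q: "q = (m, power_ideal A d z m +>\<^bsub>A\<^esub> b)" "1 \<le> m" "b \<in> S"
        and s: "s = (l, power_ideal A d z l +>\<^bsub>A\<^esub> c)" "1 \<le> l" "c \<in> S"
        unfolding lc_pairs_iff by metis
      have "eventually_equal d z (n, a) (m, b)" "eventually_equal d z (m, b) (l, c)"
        using pq qs p q s by (simp_all add: lc_rel_iff[OF z])
      then have "eventually_equal d z (n, a) (l, c)"
        by (rule eventually_equal_trans[OF _ _ z])
      then show "(p, s) \<in> lc_rel A d z"
        using p s by (simp add: lc_rel_iff[OF z])
    qed
  qed
qed

lemma lc_class_eq_iff: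
  assumes z: "\<And>i. i < d \<Longrightarrow> z i \<in> S" and "1 \<le> n" "1 \<le> m" "r \<in> S" "r' \<in> S"
  shows "lc_class A d z n r = lc_class A d z m r' \<longleftrightarrow> eventually_equal d z (n, r) (m, r')"
proof -
  have "(n, power_ideal A d z n +>\<^bsub>A\<^esub> r) \<in> lc_pairs A d z"
      "(m, power_ideal A d z m +>\<^bsub>A\<^esub> r') \<in> lc_pairs A d z"
    using assms by (auto intro: coset_in_lc_pairs)
  then show ?thesis
    unfolding lc_class_def
    using eq_equiv_class_iff[OF equiv_lc_rel[of d z, OF z]] lc_rel_iff[of d z, OF assms] by blast
qed

lemma local_cohomology_eq_classes:
  assumes z: "\<And>i. i < d \<Longrightarrow> z i \<in> S"
  shows "local_cohomology A d z = {lc_class A d z n r | n r. 1 \<le> n \<and> r \<in> S}"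
proof (intro equalityI subsetI)
  fix u assume "u \<in> local_cohomology A d z"
  then obtain p where "p \<in> lc_pairs A d z" "u = lc_rel A d z `` {p}"
    by (auto simp: local_cohomology_def elim: quotientE)
  then show "u \<in> {lc_class A d z n r | n r. 1 \<le> n \<and> r \<in> S}"
    unfolding lc_pairs_iff lc_class_def by blast
next
  fix u assume "u \<in> {lc_class A d z n r | n r. 1 \<le> n \<and> r \<in> S}"
  then obtain n r where "u = lc_class A d z n r" "1 \<le> n" "r \<in> S" by blast
  then show "u \<in> local_cohomology A d z"
    unfolding local_cohomology_def lc_class_def by (simp add: quotientI coset_in_lc_pairs)
qed

lemma eventually_equal_mult:
  assumes "eventually_equal d z (n, r) (m, r')" "a \<in> S"
  shows "eventually_equal d z (n, r * a) (m, r' * a)"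
proof -
  obtain k where k: "k \<ge> n" "m \<le> k" "(\<Prod>i<d. z i) ^ (k - n) * r - (\<Prod>i<d. z i) ^ (k - m) * r'
      \<in> ideal_span S d (\<lambda>i. z i ^ k)"
    using assms(1) by (auto simp: eventually_equal_iff)
  from ideal_span_mult[OF assms(2) k(3)]
  have "(\<Prod>i<d. z i) ^ (k - n) * (r * a) - (\<Prod>i<d. z i) ^ (k - m) * (r' * a)
      \<in> ideal_span S d (\<lambda>i. z i ^ k)"
    by (simp add: algebra_simps)
  with k show ?thesis by (auto simp: eventually_equal_iff)
qed

lemma eventually_equal_same_level:
  assumes "r - r' \<in> ideal_span S d (\<lambda>i. z i ^ n)"
  shows "eventually_equal d z (n, r) (n, r')"
  using assms unfolding eventually_equal_iff by (intro exI[of _ n]) auto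

end

section \<open>Integral elements form a ring\<close>

text \<open>
  The notion of integrality that underlies \<^const>\<open>Rplus\<close>, for an arbitrary homomorphism.
\<close>

definition integral_over_image :: "('a::comm_ring_1 \<Rightarrow> 'b::comm_ring_1) \<Rightarrow> 'b \<Rightarrow> bool" where
  "integral_over_image \<phi> z \<longleftrightarrow>
    (\<exists>p. Polynomial.lead_coeff p = 1 \<and> poly (map_poly \<phi> p) z = 0)"

context
  fixes \<phi> :: "'a::comm_ring_1 \<Rightarrow> 'b::field"
  assumes is_hom: "comm_ring_hom \<phi>"
begin

interpretation comm_ring_hom \<phi> by (rule is_hom)

interpretation M: Modules.module "\<lambda>a v. \<phi> a * v"
  by unfold_locales (auto simp: hom_distribs algebra_simps)

text \<open>
  The determinant trick.  Write multiplication by \<open>z\<close> on the generators as a matrix over the base ring.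
  The vector of the generators is an eigenvector for the eigenvalue \<open>z\<close>, so \<open>z\<close> is a root of the
  characteristic polynomial, which is monic with coefficients in the base ring.
\<close>

lemma integral_if_stable_span:
  assumes "finite T" "v \<in> T" "v \<noteq> 0"
    and stable: "\<And>v. v \<in> T \<Longrightarrow> z * v \<in> M.span T"
  shows "integral_over_image \<phi> z"
proof -
  obtain h where h: "bij_betw h {..<card T} T"
    using ex_bij_betw_nat_finite[OF assms(1)] by (auto simp: atLeast0LessThan)
  let ?n = "card T"
  have "\<exists>c. z * v = (\<Sum>w\<in>T. \<phi> (c w) * w)" if "v \<in> T" for v
    using stable[OF that] unfolding M.span_finite[OF assms(1)] by blast
  then obtain c where c: "\<And>v. v \<in> T \<Longrightarrow> z * v = (\<Sum>w\<in>T. \<phi> (c v w) * w)"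
    by metis
  define B where "B = mat ?n ?n (\<lambda>(i, j). c (h i) (h j))"
  have B: "B \<in> carrier_mat ?n ?n" by (simp add: B_def)
  have "map_mat \<phi> B *\<^sub>v vec ?n h = z \<cdot>\<^sub>v vec ?n h"
  proof (rule eq_vecI)
    fix i assume "i < dim_vec (z \<cdot>\<^sub>v vec ?n h)"
    then have i: "i < ?n" by simp
    then have "h i \<in> T" using h by (auto simp: bij_betw_def)
    have "(map_mat \<phi> B *\<^sub>v vec ?n h) $ i = (\<Sum>j<?n. \<phi> (c (h i) (h j)) * h j)"
      using i by (simp add: B_def scalar_prod_def atLeast0LessThan)
    also have "\<dots> = (\<Sum>w\<in>T. \<phi> (c (h i) w) * w)"
      by (rule sum.reindex_bij_betw[OF h])
    finally show "(map_mat \<phi> B *\<^sub>v vec ?n h) $ i = (z \<cdot>\<^sub>v vec ?n h) $ i"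
      using c[OF \<open>h i \<in> T\<close>] i by simp
  qed (simp add: B_def)
  moreover have "vec ?n h \<noteq> 0\<^sub>v ?n"
  proof
    assume eq: "vec ?n h = 0\<^sub>v ?n"
    have "v \<in> h ` {..<?n}" using h assms(2) by (simp add: bij_betw_def)
    then obtain i where "i < ?n" "h i = v" by blast
    then show False using arg_cong[OF eq, of "\<lambda>u. vec_index u i"] assms(3) by simp
  qed
  ultimately have "eigenvalue (map_mat \<phi> B) z"
    using B unfolding eigenvalue_def eigenvector_def by (intro exI[of _ "vec ?n h"]) simp
  then have "poly (char_poly (map_mat \<phi> B)) z = 0"
    using eigenvalue_root_char_poly[of "map_mat \<phi> B" ?n z] B by simp
  then have "poly (map_poly \<phi> (char_poly B)) z = 0"
    using char_poly_hom[OF B] by simp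
  moreover have "Polynomial.lead_coeff (char_poly B) = 1"
    using degree_monic_char_poly[OF B] by simp
  ultimately show ?thesis unfolding integral_over_image_def by blast
qed

lemma integral_hom: "integral_over_image \<phi> (\<phi> a)"
  unfolding integral_over_image_def
  by (intro exI[of _ "[:- a, 1:]"]) (simp add: hom_distribs)

lemma integral_power_reduction:
  assumes "integral_over_image \<phi> z"
  shows "\<exists>n c. 0 < n \<and> z ^ n = (\<Sum>i<n. \<phi> (c i) * z ^ i)"
proof -
  obtain p where p: "Polynomial.lead_coeff p = 1" "poly (map_poly \<phi> p) z = 0"
    using assms by (auto simp: integral_over_image_def)
  let ?n = "Polynomial.degree p"
  have deg: "Polynomial.degree (map_poly \<phi> p) = ?n"
    by (rule degree_map_poly) (use p in auto)
  have "poly (map_poly \<phi> p) z = (\<Sum>i\<le>?n. \<phi> (Polynomial.coeff p i) * z ^ i)"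
    by (simp add: poly_altdef deg coeff_map_poly)
  also have "\<dots> = z ^ ?n + (\<Sum>i<?n. \<phi> (Polynomial.coeff p i) * z ^ i)"
    using p(1) by (simp add: lessThan_Suc_atMost[symmetric])
  finally have "z ^ ?n + (\<Sum>i<?n. \<phi> (Polynomial.coeff p i) * z ^ i) = 0"
    using p(2) by simp
  then have eq: "z ^ ?n = (\<Sum>i<?n. \<phi> (- Polynomial.coeff p i) * z ^ i)"
    by (simp add: eq_neg_iff_add_eq_0 hom_distribs sum_negf)
  \<comment> \<open>A monic polynomial of degree 0 is 1, which has no root.\<close>
  then have "0 < ?n" by (cases "?n = 0") auto
  with eq show ?thesis by (intro exI[of _ ?n] exI[of _ "\<lambda>i. - Polynomial.coeff p i"]) simp
qed

lemma stable_span: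
  assumes "\<And>u. u \<in> T \<Longrightarrow> z * u \<in> M.span T" "v \<in> M.span T"
  shows "z * v \<in> M.span T"
  using assms(2)
proof (induction rule: M.span_induct_alt)
  case base
  then show ?case using M.span_zero by simp
next
  case (step c x y)
  have "z * (\<phi> c * x + y) = \<phi> c * (z * x) + z * y" by (simp add: algebra_simps)
  then show ?case
    using M.span_add[OF M.span_scale[OF assms(1)[OF step(1)]] step(2)] by simp
qed

text \<open>
  The monomials \<open>z\<^sup>i w\<^sup>j\<close> with exponents below the degrees of integral equations of \<open>z\<close> and \<open>w\<close> span a
  module on which both elements act, and hence their sum and their product.
\<close>

lemma common_stable_span:
  assumes "integral_over_image \<phi> z" "integral_over_image \<phi> w"
  shows "\<exists>T. finite T \<and> 1 \<in> T \<and> (\<forall>u\<in>T. z * u \<in> M.span T) \<and> (\<forall>u\<in>T. w * u \<in> M.span T)"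
proof -
  obtain n c where n: "0 < n" "z ^ n = (\<Sum>i<n. \<phi> (c i) * z ^ i)"
    using integral_power_reduction[OF assms(1)] by blast
  obtain m e where m: "0 < m" "w ^ m = (\<Sum>j<m. \<phi> (e j) * w ^ j)"
    using integral_power_reduction[OF assms(2)] by blast
  define T where "T = (\<lambda>(i, j). z ^ i * w ^ j) ` ({..<n} \<times> {..<m})"
  have mem: "z ^ i * w ^ j \<in> M.span T" if "i < n" "j < m" for i j
    using that by (intro M.span_base) (auto simp: T_def)
  have "z ^ n * w ^ j \<in> M.span T" if "j < m" for j
    unfolding n(2) sum_distrib_right mult.assoc
    using that by (intro M.span_sum M.span_scale mem) auto
  then have z: "z ^ i * w ^ j \<in> M.span T" if "i \<le> n" "j < m" for i j
    using that mem by (cases "i = n") auto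
  have mem': "w ^ j * z ^ i \<in> M.span T" if "i < n" "j < m" for i j
    using mem[OF that] by (simp add: mult.commute)
  have "w ^ m * z ^ i \<in> M.span T" if "i < n" for i
    unfolding m(2) sum_distrib_right mult.assoc
    using that by (intro M.span_sum M.span_scale mem') auto
  then have "z ^ i * w ^ m \<in> M.span T" if "i < n" for i
    using that by (metis mult.commute)
  then have w: "z ^ i * w ^ j \<in> M.span T" if "i < n" "j \<le> m" for i j
    using that mem by (cases "j = m") auto
  have "z * u \<in> M.span T \<and> w * u \<in> M.span T" if u: "u \<in> T" for u
  proof -
    obtain i j where ij: "i < n" "j < m" "u = z ^ i * w ^ j" using u by (auto simp: T_def)
    then show ?thesis using z[of "Suc i" j] w[of i "Suc j"] by (simp add: mult_ac)
  qed
  moreover have "finite T" "1 \<in> T"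
    using n(1) m(1) by (auto simp: T_def intro!: image_eqI[of _ _ "(0, 0)"])
  ultimately show ?thesis by blast
qed

lemma integral_add:
  assumes "integral_over_image \<phi> z" "integral_over_image \<phi> w"
  shows "integral_over_image \<phi> (z + w)"
proof -
  obtain T where "finite T" "1 \<in> T" "\<forall>u\<in>T. z * u \<in> M.span T" "\<forall>u\<in>T. w * u \<in> M.span T"
    using common_stable_span[OF assms] by blast
  then show ?thesis
    by (intro integral_if_stable_span[of T 1]) (auto simp: distrib_right M.span_add)
qed

lemma integral_mult:
  assumes "integral_over_image \<phi> z" "integral_over_image \<phi> w"
  shows "integral_over_image \<phi> (z * w)"
proof -
  obtain T where T: "finite T" "1 \<in> T"
    and st: "\<And>u. u \<in> T \<Longrightarrow> z * u \<in> M.span T" "\<And>u. u \<in> T \<Longrightarrow> w * u \<in> M.span T"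
    using common_stable_span[OF assms] by blast
  show ?thesis
  proof (rule integral_if_stable_span[OF T])
    fix v assume "v \<in> T"
    from stable_span[OF st(1) st(2)[OF this]] show "z * w * v \<in> M.span T"
      by (simp add: mult.assoc)
  qed simp
qed

end

lemma comm_ring_hom_to_abs_closure: "comm_ring_hom to_abs_closure"
  by unfold_locales (auto simp: to_abs_closure_def)

section \<open>The comparison map\<close>

text \<open>
  The setting in which the comparison map makes sense: a ring \<open>S\<close> of coefficients that receives the
  ring in which the matrices are taken.
\<close>

locale coefficient_subring = type_subring S + comm_ring_hom \<phi>
  for S :: "'b::comm_ring_1 set" and \<phi> :: "'a::comm_ring_1 \<Rightarrow> 'b" +
  assumes hom_mem: "\<phi> a \<in> S"
begin

lemma hom_ideal_span:
  assumes "a \<in> ideal_span UNIV d f"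
  shows "\<phi> a \<in> ideal_span S d (\<lambda>i. \<phi> (f i))"
proof -
  obtain c where "a = (\<Sum>i<d. c i * f i)" using assms by (auto simp: ideal_span_def)
  then have "\<phi> a = (\<Sum>i<d. \<phi> (c i) * \<phi> (f i))" by (simp add: hom_distribs)
  then show ?thesis
    unfolding ideal_span_def using hom_mem by (intro CollectI exI[of _ "\<lambda>i. \<phi> (c i)"]) simp
qed

text \<open>
  By Cramer's rule, multiplication by \<open>det C\<close> maps \<open>(x)\<close> into \<open>(z)\<close>, so it is defined on residue
  classes.
\<close>

lemma ideal_span_times_det:
  assumes C: "transforms d C x z" and a: "a \<in> ideal_span S d (\<lambda>i. \<phi> (x i))"
  shows "a * \<phi> (det C) \<in> ideal_span S d (\<lambda>i. \<phi> (z i))"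
proof -
  obtain c where c: "\<forall>i<d. c i \<in> S" "a = (\<Sum>i<d. c i * \<phi> (x i))"
    using a by (auto simp: ideal_span_def)
  have "a * \<phi> (det C) = (\<Sum>i<d. c i * \<phi> (det C * x i))"
    unfolding c(2) by (simp add: sum_distrib_right hom_distribs mult_ac)
  also have "\<dots> \<in> ideal_span S d (\<lambda>i. \<phi> (z i))"
  proof (intro ideal_span_sum ideal_span_mult hom_ideal_span)
    fix i assume i: "i \<in> {..<d}"
    then show "c i \<in> S" using c(1) by simp
    show "det C * x i \<in> ideal_span UNIV d z"
      using det_times_transformed[OF C] i by (auto simp: ideal_span_UNIV_iff)
  qed
  finally show ?thesis .
qed

lemma det_class_independent:
  assumes "transforms d B w (\<lambda>i. y i ^ s)" "transforms d B' w (\<lambda>i. y i ^ s')"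
  shows "eventually_equal d (\<lambda>i. \<phi> (y i)) (s, \<phi> (det B)) (s', \<phi> (det B'))"
proof -
  obtain k where k: "k \<ge> s" "s' \<le> k"
    and mem: "(\<Prod>i<d. y i) ^ (k - s) * det B - (\<Prod>i<d. y i) ^ (k - s') * det B'
      \<in> ideal_span UNIV d (\<lambda>i. y i ^ k)"
    using det_independent[OF assms] by blast
  from hom_ideal_span[OF mem]
  have "(\<Prod>i<d. \<phi> (y i)) ^ (k - s) * \<phi> (det B) - (\<Prod>i<d. \<phi> (y i)) ^ (k - s') * \<phi> (det B')
      \<in> ideal_span S d (\<lambda>i. \<phi> (y i) ^ k)"
    by (simp add: hom_distribs)
  with k show ?thesis unfolding eventually_equal_iff by blast
qed

text \<open>
  Move both fractions to a common level \<open>k\<close> at which their difference vanishes modulo \<open>(x\<^sup>k)\<close>, and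
  choose one matrix \<open>C\<close> with \<open>y\<^sup>t = C x\<^sup>k\<close> there.  By independence of the determinant both images may be
  computed with \<open>C\<close>, times the diagonal matrix of the \<open>x\<^sub>i\<^bsup>k-n\<^esup>\<close>, instead of \<open>B\<close> and \<open>B'\<close>; and
  \<open>det C\<close> kills the difference modulo \<open>(y\<^sup>t)\<close>.
\<close>

lemma comparison_well_defined:
  assumes rad: "\<And>i. i < d \<Longrightarrow> \<exists>e. y i ^ e \<in> ideal_span UNIV d x"
    and rr': "eventually_equal d (\<lambda>i. \<phi> (x i)) (n, r) (n', r')" "r \<in> S" "r' \<in> S"
    and B: "transforms d B (\<lambda>i. x i ^ n) (\<lambda>i. y i ^ s)"
    and B': "transforms d B' (\<lambda>i. x i ^ n') (\<lambda>i. y i ^ s')"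
  shows "eventually_equal d (\<lambda>i. \<phi> (y i)) (s, r * \<phi> (det B)) (s', r' * \<phi> (det B'))"
proof -
  let ?P = "\<Prod>i<d. x i" and ?eq = "eventually_equal d (\<lambda>i. \<phi> (y i))"
  have hy: "\<And>i. i < d \<Longrightarrow> \<phi> (y i) \<in> S" by (rule hom_mem)
  obtain k where k: "k \<ge> n" "k \<ge> n'" "(\<Prod>i<d. \<phi> (x i)) ^ (k - n) * r - (\<Prod>i<d. \<phi> (x i)) ^ (k - n') * r'
      \<in> ideal_span S d (\<lambda>i. \<phi> (x i) ^ k)"
    using rr'(1) by (auto simp: eventually_equal_iff)
  obtain t C where C: "transforms d C (\<lambda>i. x i ^ k) (\<lambda>i. y i ^ t)"
    using common_power_transforms[of d y x k, OF rad] by blast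
  have step: "?eq (s, r * \<phi> (det B)) (t, r * \<phi> (det C * ?P ^ (k - n)))"
    if B: "transforms d B (\<lambda>i. x i ^ n) (\<lambda>i. y i ^ s)" and r: "r \<in> S" and kn: "n \<le> k" for B n s r
  proof -
    have "(\<lambda>i. x i ^ (k - n) * x i ^ n) = (\<lambda>i. x i ^ k)"
      using kn by (simp flip: power_add)
    then have "transforms d (mat_diag d (\<lambda>i. x i ^ (k - n))) (\<lambda>i. x i ^ n) (\<lambda>i. x i ^ k)"
      using transforms_diag[of d "\<lambda>i. x i ^ (k - n)" "\<lambda>i. x i ^ n"] by simp
    from det_class_independent[OF B transforms_mult[OF this C]]
    have "?eq (s, \<phi> (det B)) (t, \<phi> (det (C * mat_diag d (\<lambda>i. x i ^ (k - n)))))" .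
    also have "det (C * mat_diag d (\<lambda>i. x i ^ (k - n))) = det C * ?P ^ (k - n)"
      using C by (simp add: transforms_def det_mult[of _ d] det_mat_diag prod_power_distrib)
    finally have "?eq (s, \<phi> (det B)) (t, \<phi> (det C * ?P ^ (k - n)))" .
    from eventually_equal_mult[OF this r] show ?thesis by (simp only: mult.commute)
  qed
  have "r * \<phi> (det C * ?P ^ (k - n)) - r' * \<phi> (det C * ?P ^ (k - n')) =
      ((\<Prod>i<d. \<phi> (x i)) ^ (k - n) * r - (\<Prod>i<d. \<phi> (x i)) ^ (k - n') * r') * \<phi> (det C)"
    by (simp add: hom_distribs algebra_simps)
  also have "\<dots> \<in> ideal_span S d (\<lambda>i. \<phi> (y i) ^ t)"
    using ideal_span_times_det[OF C] k(3) by (simp add: hom_distribs)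
  finally have "?eq (t, r * \<phi> (det C * ?P ^ (k - n))) (t, r' * \<phi> (det C * ?P ^ (k - n')))"
    by (rule eventually_equal_same_level)
  from eventually_equal_trans[OF step[OF B rr'(2) k(1)] this hy]
  show ?thesis
    using eventually_equal_trans[OF _ eventually_equal_sym[OF step[OF B' rr'(3) k(2)]] hy] by blast
qed

text \<open>
  Matrices \<open>E\<close> and \<open>E'\<close> lead from powers of \<open>y\<close> back to powers of \<open>x\<close>.  By well-definedness in this
  direction, the assumed equality persists after multiplication by \<open>det E\<close> and \<open>det E'\<close>.  But
  \<open>E B\<close> carries \<open>x\<^sup>n\<close> to \<open>x\<^sup>N\<close>, as the identity matrix carries \<open>x\<^sup>n\<close> to \<open>x\<^sup>n\<close>, so the factor
  \<open>det (E B)\<close> over \<open>x\<^sup>N\<close> is the same as the factor \<open>1\<close> over \<open>x\<^sup>n\<close>, and the original fraction returns.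
\<close>

lemma comparison_injective:
  assumes rad: "\<And>i. i < d \<Longrightarrow> \<exists>e. x i ^ e \<in> ideal_span UNIV d y"
    and rr': "r \<in> S" "r' \<in> S"
    and B: "transforms d B (\<lambda>i. x i ^ n) (\<lambda>i. y i ^ s)"
    and B': "transforms d B' (\<lambda>i. x i ^ n') (\<lambda>i. y i ^ s')"
    and eq: "eventually_equal d (\<lambda>i. \<phi> (y i)) (s, r * \<phi> (det B)) (s', r' * \<phi> (det B'))"
  shows "eventually_equal d (\<lambda>i. \<phi> (x i)) (n, r) (n', r')"
proof -
  let ?eq = "eventually_equal d (\<lambda>i. \<phi> (x i))"
  have hx: "\<And>i. i < d \<Longrightarrow> \<phi> (x i) \<in> S" by (rule hom_mem)
  obtain N E where E: "transforms d E (\<lambda>i. y i ^ s) (\<lambda>i. x i ^ N)"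
    using common_power_transforms[of d x y s, OF rad] by blast
  obtain N' E' where E': "transforms d E' (\<lambda>i. y i ^ s') (\<lambda>i. x i ^ N')"
    using common_power_transforms[of d x y s', OF rad] by blast
  have return_det: "?eq (N, r * \<phi> (det B) * \<phi> (det E)) (n, r)"
    if B: "transforms d B (\<lambda>i. x i ^ n) (\<lambda>i. y i ^ s)"
      and E: "transforms d E (\<lambda>i. y i ^ s) (\<lambda>i. x i ^ N)" and r: "r \<in> S" for B E n s N r
  proof -
    have "?eq (N, \<phi> (det (E * B))) (n, \<phi> (det (1\<^sub>m d)))"
      by (rule det_class_independent[OF transforms_mult[OF B E] transforms_one])
    from eventually_equal_mult[OF this r] show ?thesis
      using B E by (simp add: transforms_def det_mult[of _ d] hom_distribs mult_ac)
  qed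
  have "?eq (N, r * \<phi> (det B) * \<phi> (det E)) (N', r' * \<phi> (det B') * \<phi> (det E'))"
    using rr' by (intro comparison_well_defined[OF rad eq _ _ E E'] mult_mem hom_mem)
  from eventually_equal_trans[OF this return_det[OF B' E' rr'(2)] hx]
  show ?thesis
    using eventually_equal_trans[OF eventually_equal_sym[OF return_det[OF B E rr'(1)]] _ hx] by blast
qed

end

lemma coefficient_subring_Rplus:
  "coefficient_subring {z. integral_over_base z} (to_abs_closure :: 'a::idom \<Rightarrow> _)"
proof -
  interpret comm_ring_hom "to_abs_closure :: 'a \<Rightarrow> _" by (rule comm_ring_hom_to_abs_closure)
  have eq: "integral_over_base = integral_over_image (to_abs_closure :: 'a \<Rightarrow> _)"
    by (auto simp: integral_over_base_def integral_over_image_def)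
  note int = integral_hom[OF comm_ring_hom_to_abs_closure]
    integral_add[OF comm_ring_hom_to_abs_closure] integral_mult[OF comm_ring_hom_to_abs_closure]
  have "integral_over_image (to_abs_closure :: 'a \<Rightarrow> _) (- a)"
    if "integral_over_image to_abs_closure a" for a
    using int(3)[OF int(1)[of "- 1"] that] by (simp add: hom_distribs)
  moreover have "integral_over_image (to_abs_closure :: 'a \<Rightarrow> _) 1"
    using int(1)[of "1 :: 'a"] by simp
  ultimately show ?thesis
    unfolding eq by unfold_locales (auto intro: int)
qed

interpretation Rplus: coefficient_subring "{z. integral_over_base z}" "to_abs_closure :: 'a::idom \<Rightarrow> _"
  by (rule coefficient_subring_Rplus)

lemma carrier_Rplus: "carrier Rplus = {z. integral_over_base z}"
  by (simp add: Rplus_def)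

lemma H_plus_eq_classes:
  "H_plus d x = {H_plus_class d x n r | n r. 1 \<le> n \<and> r \<in> carrier Rplus}"
  using Rplus.local_cohomology_eq_classes[of d "\<lambda>i. to_abs_closure (x i)", OF Rplus.hom_mem]
  by (simp add: H_plus_def H_plus_class_def Rplus_def)

lemma H_plus_class_eq_iff:
  assumes "1 \<le> n" "1 \<le> m" "r \<in> carrier Rplus" "r' \<in> carrier Rplus"
  shows "H_plus_class d x n r = H_plus_class d x m r' \<longleftrightarrow>
    Rplus.eventually_equal d (\<lambda>i. to_abs_closure (x i)) (n, r) (m, r')"
  using Rplus.lc_class_eq_iff[of d "\<lambda>i. to_abs_closure (x i)" n m r r', OF Rplus.hom_mem] assms
  by (simp add: H_plus_class_def Rplus_def)

text \<open>
  The definite description in \<^const>\<open>Phi\<close> is met by any choice of data, because the result does not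
  depend on the choice.
\<close>

lemma Phi_class:
  assumes rad: "\<And>i. i < d \<Longrightarrow> \<exists>e. y i ^ e \<in> ideal_span UNIV d x"
    and "1 \<le> n" "r \<in> carrier Rplus" "1 \<le> s" and B: "transforms d B (\<lambda>i. x i ^ n) (\<lambda>i. y i ^ s)"
  shows "Phi d x y (H_plus_class d x n r) = H_plus_class d y s (r * to_abs_closure (det B))"
  unfolding Phi_def
proof (rule the_equality)
  show "\<exists>n' r' s' B'. 1 \<le> n' \<and> r' \<in> carrier Rplus \<and> H_plus_class d x n r = H_plus_class d x n' r' \<and>
     1 \<le> s' \<and> B' \<in> carrier_mat d d \<and> (\<forall>i<d. y i ^ s' = (\<Sum>j<d. B' $$ (i, j) * x j ^ n')) \<and>
     H_plus_class d y s (r * to_abs_closure (det B)) = H_plus_class d y s' (r' * to_abs_closure (det B'))"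
    using assms unfolding transforms_def by blast
next
  fix v
  assume "\<exists>n' r' s' B'. 1 \<le> n' \<and> r' \<in> carrier Rplus \<and> H_plus_class d x n r = H_plus_class d x n' r' \<and>
     1 \<le> s' \<and> B' \<in> carrier_mat d d \<and> (\<forall>i<d. y i ^ s' = (\<Sum>j<d. B' $$ (i, j) * x j ^ n')) \<and>
     v = H_plus_class d y s' (r' * to_abs_closure (det B'))"
  then obtain n' r' s' B' where n': "1 \<le> n'" "r' \<in> carrier Rplus" "1 \<le> s'"
    and eq: "H_plus_class d x n r = H_plus_class d x n' r'"
    and B': "transforms d B' (\<lambda>i. x i ^ n') (\<lambda>i. y i ^ s')"
    and v: "v = H_plus_class d y s' (r' * to_abs_closure (det B'))"
    unfolding transforms_def by blast
  have "Rplus.eventually_equal d (\<lambda>i. to_abs_closure (x i)) (n, r) (n', r')"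
    using eq H_plus_class_eq_iff[OF assms(2) n'(1) assms(3) n'(2)] by simp
  then have "Rplus.eventually_equal d (\<lambda>i. to_abs_closure (y i))
      (s, r * to_abs_closure (det B)) (s', r' * to_abs_closure (det B'))"
    using assms(3) n'(2) unfolding carrier_Rplus
    by (intro Rplus.comparison_well_defined[OF rad _ _ _ B B'])
  then show "v = H_plus_class d y s (r * to_abs_closure (det B))"
    unfolding v using assms(3,4) n'(2,3) Rplus.mult_mem Rplus.hom_mem
    by (subst eq_commute, subst H_plus_class_eq_iff) (auto simp: carrier_Rplus)
qed

lemma inj_on_Phi:
  assumes yx: "\<And>i. i < d \<Longrightarrow> \<exists>e. y i ^ e \<in> ideal_span UNIV d x"
    and xy: "\<And>i. i < d \<Longrightarrow> \<exists>e. x i ^ e \<in> ideal_span UNIV d y"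
  shows "inj_on (Phi d x y) (H_plus d x)"
proof (rule inj_onI)
  fix u u' assume "u \<in> H_plus d x" "u' \<in> H_plus d x" and eq: "Phi d x y u = Phi d x y u'"
  then obtain n r n' r' where u: "u = H_plus_class d x n r" "1 \<le> n" "r \<in> carrier Rplus"
    and u': "u' = H_plus_class d x n' r'" "1 \<le> n'" "r' \<in> carrier Rplus"
    unfolding H_plus_eq_classes by blast
  obtain s B where B: "1 \<le> s" "transforms d B (\<lambda>i. x i ^ n) (\<lambda>i. y i ^ s)"
    using common_power_transforms[of d y x n, OF yx] by blast
  obtain s' B' where B': "1 \<le> s'" "transforms d B' (\<lambda>i. x i ^ n') (\<lambda>i. y i ^ s')"
    using common_power_transforms[of d y x n', OF yx] by blast
  have "H_plus_class d y s (r * to_abs_closure (det B)) = H_plus_class d y s' (r' * to_abs_closure (det B'))"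
    using eq Phi_class[OF yx u(2,3) B] Phi_class[OF yx u'(2,3) B'] unfolding u(1) u'(1) by simp
  moreover have "r * to_abs_closure (det B) \<in> carrier Rplus" "r' * to_abs_closure (det B') \<in> carrier Rplus"
    using u(3) u'(3) Rplus.mult_mem Rplus.hom_mem by (auto simp: carrier_Rplus)
  ultimately have "Rplus.eventually_equal d (\<lambda>i. to_abs_closure (y i))
      (s, r * to_abs_closure (det B)) (s', r' * to_abs_closure (det B'))"
    using H_plus_class_eq_iff[OF B(1) B'(1)] by blast
  then have "Rplus.eventually_equal d (\<lambda>i. to_abs_closure (x i)) (n, r) (n', r')"
    using u(3) u'(3) unfolding carrier_Rplus
    by (intro Rplus.comparison_injective[OF xy _ _ B(2) B'(2)])
  then show "u = u'"
    unfolding u(1) u'(1) using H_plus_class_eq_iff[OF u(2) u'(2) u(3) u'(3)] by blast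
qed

lemma Idl_type_ring:
  fixes f :: "nat \<Rightarrow> 'a::comm_ring_1"
  shows "Idl\<^bsub>ring_of_type_algebra\<^esub> (f ` {..<d}) = ideal_span UNIV d f"
proof -
  have A: "ring_of_type_algebra\<lparr>carrier := UNIV\<rparr> = (ring_of_type_algebra :: 'a ring)"
    by (simp add: ring_of_type_algebra_def)
  show ?thesis using full.Idl_eq_ideal_span[of d f, unfolded A] by simp
qed

theorem proposition3p4:
  fixes R :: "'a::idom ring" and p d :: nat and x y :: "nat \<Rightarrow> 'a"
  defines "R \<equiv> ring_of_type_algebra"
  assumes "noetherian_ring R"
    and "local_ring R"
    and "CHAR('a) = p" and "p > 0"
    and "krull_dim R = enat d"
    and "system_of_parameters R d x"
    and "Idl\<^bsub>R\<^esub> (y ` {..<d}) \<subseteq> Idl\<^bsub>R\<^esub> (x ` {..<d})"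
    and "system_of_parameters R d y"
  shows "inj_on (Phi d x y) (H_plus d x)"
proof (rule inj_on_Phi)
  fix i assume i: "i < d"
  have Idl: "Idl\<^bsub>R\<^esub> (f ` {..<d}) = ideal_span UNIV d f" for f
    unfolding R_def by (rule Idl_type_ring)
  have pow: "a [^]\<^bsub>R\<^esub> (n::nat) = a ^ n" for a n
    unfolding R_def using full.A_pow[of a n] by (simp add: ring_of_type_algebra_def)
  have "y i ^ 1 \<in> ideal_span UNIV d x"
    using assms(8) full.ideal_span_generator[OF i, of y] unfolding Idl by auto
  then show "\<exists>e. y i ^ e \<in> ideal_span UNIV d x" by blast
  \<comment> \<open>Both radicals are maximal ideals of a local ring.\<close>
  have "ideal_radical R (Idl\<^bsub>R\<^esub> (x ` {..<d})) = ideal_radical R (Idl\<^bsub>R\<^esub> (y ` {..<d}))"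
    using assms(3,7,9) unfolding local_ring_def system_of_parameters_def by blast
  moreover have "x i ^ 1 \<in> ideal_span UNIV d x"
    using full.ideal_span_generator[OF i, of x] by simp
  then have "\<exists>e. x i ^ e \<in> ideal_span UNIV d x" by blast
  then have "x i \<in> ideal_radical R (Idl\<^bsub>R\<^esub> (x ` {..<d}))"
    unfolding ideal_radical_def Idl pow by (simp add: R_def)
  ultimately show "\<exists>e. x i ^ e \<in> ideal_span UNIV d y"
    unfolding ideal_radical_def Idl pow by blast
qed

end
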